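(* Let $S$ be a $*$-monoid and let $a\in S$. Then the following conditions are equivalent: (i) $a$ is $a^*$-core invertible. (ii) $a$ is Moore-Penrose invertible. (iii) $a$ is dual $a^*$-core invertible. In this case, writing $a^\dagger$ for the Moore-Penrose inverse of $a$, $a_{a^*}^{\#}$ for the $a^*$-core inverse of $a$ and $a_{a^*,\#}$ for the dual $a^*$-core inverse of $a$, one has $a^\dagger=(a_{a^*}^{\#}a)^*=(a\,a_{a^*,\#})^*$, $a_{a^*}^{\#}=(a^\dagger)^*a^\dagger$ and $a_{a^*,\#}=a^\dagger(a^\dagger)^*$.
   Context: A $*$-monoid is a semigroup $S$ with identity $1$ and a map $*$ satisfying $(x^* )^*=x$ and $(xy)^*=y^*x^*$ for all $x,y\in S$. For $a,w\in S$, $a$ is $w$-core invertible if there exists $x\in S$ with $awx^2=x$, $xawa=a$ and $(awx)^*=awx$. Such an $x$ is unique if it exists and is called the $w$-core inverse of $a$. For $a,v\in S$, $a$ is dual $v$-core invertible if there exists $y\in S$ with $avay=a$, $y^2va=y$ and $(yva)^*=yva$. Such a $y$ is unique if it exists and is called the dual $v$-core inverse of $a$. The Moore-Penrose inverse of $a$ is the (unique, if it exists) $x\in S$ with $axa=a$, $xax=x$, $(ax)^*=ax$, $(xa)^*=xa$. *)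

theory Defs
  imports Main
begin

class star_monoid = monoid_mult +
  fixes star :: "'a \<Rightarrow> 'a"  ("_\<^sup>\<star>" [1000] 999)
  assumes star_star: "(x\<^sup>\<star>)\<^sup>\<star> = x"
    and star_mult: "(x * y)\<^sup>\<star> = y\<^sup>\<star> * x\<^sup>\<star>"

(* In each predicate below the parameter w (or v) comes first, then the element a,
   then the candidate inverse. *)

definition is_w_core_inverse :: "'a::star_monoid \<Rightarrow> 'a \<Rightarrow> 'a \<Rightarrow> bool" where
  "is_w_core_inverse w a x \<longleftrightarrow>
     a * w * x\<^sup>2 = x \<and> x * a * w * a = a \<and> (a * w * x)\<^sup>\<star> = a * w * x"

definition w_core_invertible :: "'a::star_monoid \<Rightarrow> 'a \<Rightarrow> bool" where
  "w_core_invertible w a \<longleftrightarrow> (\<exists>x. is_w_core_inverse w a x)"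

definition is_dual_v_core_inverse :: "'a::star_monoid \<Rightarrow> 'a \<Rightarrow> 'a \<Rightarrow> bool" where
  "is_dual_v_core_inverse v a y \<longleftrightarrow>
     a * v * a * y = a \<and> y\<^sup>2 * v * a = y \<and> (y * v * a)\<^sup>\<star> = y * v * a"

definition dual_v_core_invertible :: "'a::star_monoid \<Rightarrow> 'a \<Rightarrow> bool" where
  "dual_v_core_invertible v a \<longleftrightarrow> (\<exists>y. is_dual_v_core_inverse v a y)"

definition is_mp_inverse :: "'a::star_monoid \<Rightarrow> 'a \<Rightarrow> bool" where
  "is_mp_inverse a x \<longleftrightarrow>
     a * x * a = a \<and> x * a * x = x \<and> (a * x)\<^sup>\<star> = a * x \<and> (x * a)\<^sup>\<star> = x * a"

definition mp_invertible :: "'a::star_monoid \<Rightarrow> bool" where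
  "mp_invertible a \<longleftrightarrow> (\<exists>x. is_mp_inverse a x)"

lemma is_w_core_inverse_unique:
  fixes a w x y :: "'a::star_monoid"
  assumes x: "is_w_core_inverse w a x" and y: "is_w_core_inverse w a y"
  shows "x = y"
proof -
  define c where "c = a * w"
  have c1: "c * (z * z) = z" "z * (c * c) = c" "(c * z)\<^sup>\<star> = c * z"
    if "is_w_core_inverse w a z" for z
  proof -
    have z: "a * w * (z * z) = z" "z * a * w * a = a" "(a * w * z)\<^sup>\<star> = a * w * z"
      using that by (auto simp: is_w_core_inverse_def power2_eq_square)
    show "c * (z * z) = z" "(c * z)\<^sup>\<star> = c * z" using z by (auto simp: c_def)
    have "z * (c * c) = (z * a * w * a) * w" by (simp add: c_def mult.assoc)
    then show "z * (c * c) = c" using z by (simp add: c_def)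
  qed
  have c2: "z * (c * z) = z" "c * (z * c) = c" if "is_w_core_inverse w a z" for z
  proof -
    have "z * (c * z) = z * (c * (c * (z * z)))" using c1(1)[OF that] by simp
    also have "\<dots> = z * (c * c) * (z * z)" by (simp add: mult.assoc)
    also have "\<dots> = z" using c1[OF that] by simp
    finally show "z * (c * z) = z" .
    have "c * (z * c) = c * (z * (z * (c * c)))" using c1(2)[OF that] by simp
    also have "\<dots> = c * (z * z) * (c * c)" by (simp add: mult.assoc)
    also have "\<dots> = c" using c1[OF that] by simp
    finally show "c * (z * c) = c" .
  qed
  have "c * x = (c * y) * (c * x)" using c2(2)[OF y] by (simp add: mult.assoc[symmetric])
  then have "(c * x)\<^sup>\<star> = ((c * y) * (c * x))\<^sup>\<star>" by simp
  then have "c * x = (c * x) * (c * y)" using c1(3)[OF x] c1(3)[OF y] star_mult[of "c * y" "c * x"] by simp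
  also have "\<dots> = c * y" using c2(2)[OF x] by (simp add: mult.assoc[symmetric])
  finally have cxy: "c * x = c * y" .
  have "x = x * (c * y)" using c2(1)[OF x] cxy by simp
  also have "\<dots> = x * (c * (c * (y * y)))" using c1(1)[OF y] by simp
  also have "\<dots> = x * (c * c) * (y * y)" by (simp add: mult.assoc)
  also have "\<dots> = y" using c1(1)[OF y] c1(2)[OF x] by simp
  finally show ?thesis .
qed

lemma is_dual_v_core_inverse_unique:
  fixes a v x y :: "'a::star_monoid"
  assumes x: "is_dual_v_core_inverse v a x" and y: "is_dual_v_core_inverse v a y"
  shows "x = y"
proof -
  define c where "c = v * a"
  have c1: "z * z * c = z" "c * c * z = c" "(z * c)\<^sup>\<star> = z * c"
    if "is_dual_v_core_inverse v a z" for z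
  proof -
    have z: "z * z * v * a = z" "a * v * a * z = a" "(z * v * a)\<^sup>\<star> = z * v * a"
      using that by (auto simp: is_dual_v_core_inverse_def power2_eq_square)
    show "z * z * c = z" "(z * c)\<^sup>\<star> = z * c" using z by (auto simp: c_def mult.assoc)
    have "c * c * z = v * (a * v * a * z)" by (simp add: c_def mult.assoc)
    then show "c * c * z = c" using z by (simp add: c_def)
  qed
  have c2: "z * c * z = z" "c * z * c = c" if "is_dual_v_core_inverse v a z" for z
  proof -
    have "z * c * z = z * z * c * c * z" using c1(1)[OF that] by simp
    also have "\<dots> = z * z * (c * c * z)" by (simp add: mult.assoc)
    also have "\<dots> = z" using c1[OF that] by simp
    finally show "z * c * z = z" .
    have "c * z * c = c * c * z * z * c" using c1(2)[OF that] by simp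
    also have "\<dots> = c * c * (z * z * c)" by (simp add: mult.assoc)
    also have "\<dots> = c" using c1[OF that] by simp
    finally show "c * z * c = c" .
  qed
  have "x * c = (x * c) * (y * c)" using c2(2)[OF y] by (simp add: mult.assoc)
  then have "(x * c)\<^sup>\<star> = ((x * c) * (y * c))\<^sup>\<star>" by simp
  then have "x * c = (y * c) * (x * c)" using c1(3)[OF x] c1(3)[OF y] star_mult[of "x * c" "y * c"] by simp
  also have "\<dots> = y * c" using c2(2)[OF x] by (simp add: mult.assoc)
  finally have cxy: "x * c = y * c" .
  have "x = y * c * x" using c2(1)[OF x] cxy by simp
  also have "\<dots> = y * y * c * c * x" using c1(1)[OF y] by simp
  also have "\<dots> = y * y * (c * c * x)" by (simp add: mult.assoc)
  also have "\<dots> = y" using c1(1)[OF y] c1(2)[OF x] by simp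
  finally show ?thesis .
qed

lemma is_mp_inverse_unique:
  fixes a x y :: "'a::star_monoid"
  assumes x: "is_mp_inverse a x" and y: "is_mp_inverse a y"
  shows "x = y"
proof -
  note X = x[unfolded is_mp_inverse_def] and Y = y[unfolded is_mp_inverse_def]
  have "a * x = (a * y) * (a * x)" using Y by (simp add: mult.assoc[symmetric])
  then have "(a * x)\<^sup>\<star> = ((a * y) * (a * x))\<^sup>\<star>" by simp
  then have "a * x = (a * x) * (a * y)" using X Y star_mult[of "a * y" "a * x"] by simp
  also have "\<dots> = a * y" using X by (simp add: mult.assoc[symmetric])
  finally have l: "a * x = a * y" .
  have "x * a = (x * a) * (y * a)" using Y by (simp add: mult.assoc)
  then have "(x * a)\<^sup>\<star> = ((x * a) * (y * a))\<^sup>\<star>" by simp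
  then have "x * a = (y * a) * (x * a)" using X Y star_mult[of "x * a" "y * a"] by simp
  also have "\<dots> = y * a" using X by (simp add: mult.assoc)
  finally have r: "x * a = y * a" .
  have "x = x * a * x" using X by simp
  also have "\<dots> = y * (a * x)" using r by (simp add: mult.assoc)
  also have "\<dots> = y" using l Y by (simp add: mult.assoc[symmetric])
  finally show ?thesis .
qed

(* By the uniqueness lemmas above, each of the following is the actual inverse whenever
   one exists; otherwise its value is unspecified. *)

definition w_core_inverse :: "'a::star_monoid \<Rightarrow> 'a \<Rightarrow> 'a" where
  "w_core_inverse w a = (THE x. is_w_core_inverse w a x)"

definition dual_v_core_inverse :: "'a::star_monoid \<Rightarrow> 'a \<Rightarrow> 'a" where
  "dual_v_core_inverse v a = (THE y. is_dual_v_core_inverse v a y)"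

definition mp_inverse :: "'a::star_monoid \<Rightarrow> 'a"  ("_\<^sup>\<dagger>" [1000] 999) where
  "a\<^sup>\<dagger> = (THE x. is_mp_inverse a x)"

end

(* If x is the a^*-core inverse of a and c = a a^*, then c x^2 = x together with c x = x^* c gives
   x = x^* c x, so x is Hermitian and commutes with c; hence a^* x is the Moore-Penrose inverse
   of a. Conversely, m^* m is an a^*-core inverse whenever m is the Moore-Penrose inverse. The
   dual statements follow by applying the involution, i.e. by passing from a to a^*. *)

theory Submission
  imports Defs
begin

lemma w_core_inverse_star_hermitian:
  fixes a x :: "'a::star_monoid"
  assumes "is_w_core_inverse (a\<^sup>\<star>) a x"
  shows "x\<^sup>\<star> = x"
proof -
  have x: "a * a\<^sup>\<star> * x * x = x" and h: "(a * a\<^sup>\<star> * x)\<^sup>\<star> = a * a\<^sup>\<star> * x"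
    using assms by (auto simp: is_w_core_inverse_def power2_eq_square mult.assoc)
  have "x = x\<^sup>\<star> * a * a\<^sup>\<star> * x"
    using x h by (simp add: star_mult star_star mult.assoc[symmetric])
  moreover have "(x\<^sup>\<star> * a * a\<^sup>\<star> * x)\<^sup>\<star> = x\<^sup>\<star> * a * a\<^sup>\<star> * x"
    by (simp add: star_mult star_star mult.assoc)
  ultimately show ?thesis by simp
qed

lemma is_mp_inverse_of_w_core:
  fixes a x :: "'a::star_monoid"
  assumes "is_w_core_inverse (a\<^sup>\<star>) a x"
  shows "is_mp_inverse a ((x * a)\<^sup>\<star>)"
proof -
  have s: "x\<^sup>\<star> = x" using assms by (rule w_core_inverse_star_hermitian)
  have x1: "a * a\<^sup>\<star> * x * x = x" and x2: "x * a * a\<^sup>\<star> * a = a"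
    and x3: "(a * a\<^sup>\<star> * x)\<^sup>\<star> = a * a\<^sup>\<star> * x"
    using assms by (auto simp: is_w_core_inverse_def power2_eq_square mult.assoc)
  \<comment> \<open>Starring \<open>a * a\<^sup>\<star> * x\<close> reverses its factors; as
    \<open>x\<close> is Hermitian, the condition \<open>x3\<close> becomes commutation with
    \<open>a * a\<^sup>\<star>\<close>.\<close>
  have comm: "x * a * a\<^sup>\<star> = a * a\<^sup>\<star> * x"
    using x3 s by (simp add: star_mult star_star mult.assoc)
  have m: "(x * a)\<^sup>\<star> = a\<^sup>\<star> * x" by (simp add: star_mult s)
  have "a * (a\<^sup>\<star> * x) * a = a"
    using x2 comm by (simp add: mult.assoc[symmetric])
  moreover have "(a\<^sup>\<star> * x) * a * (a\<^sup>\<star> * x) = a\<^sup>\<star> * x"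
  proof -
    have "(a\<^sup>\<star> * x) * a * (a\<^sup>\<star> * x) = a\<^sup>\<star> * (x * a * a\<^sup>\<star> * x)" by (simp add: mult.assoc)
    then show ?thesis using comm x1 by simp
  qed
  moreover have "((a\<^sup>\<star> * x) * a)\<^sup>\<star> = (a\<^sup>\<star> * x) * a"
    by (simp add: star_mult star_star s mult.assoc)
  ultimately show ?thesis
    using x3 by (simp add: is_mp_inverse_def m mult.assoc)
qed

text \<open>Multiplying the witness by \<open>a * a\<^sup>\<star>\<close> collapses to the
  projection \<open>a * m\<close>. The three conditions follow from this identity, its star, and
  \<open>a * m * m\<^sup>\<star> = m\<^sup>\<star>\<close>.\<close>

lemma is_w_core_inverse_of_mp:
  fixes a m :: "'a::star_monoid"
  assumes "is_mp_inverse a m"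
  shows "is_w_core_inverse (a\<^sup>\<star>) a (m\<^sup>\<star> * m)"
proof -
  have m: "a * m * a = a" "m * a * m = m" and r: "m\<^sup>\<star> * a\<^sup>\<star> = a * m" and l: "a\<^sup>\<star> * m\<^sup>\<star> = m * a"
    using assms by (auto simp: is_mp_inverse_def star_mult)
  have ax: "a * a\<^sup>\<star> * (m\<^sup>\<star> * m) = a * m"
  proof -
    have "a * a\<^sup>\<star> * (m\<^sup>\<star> * m) = a * (a\<^sup>\<star> * m\<^sup>\<star>) * m" by (simp add: mult.assoc)
    also have "\<dots> = (a * m * a) * m" by (simp add: l mult.assoc)
    finally show ?thesis by (simp add: m)
  qed
  \<comment> \<open>Since \<open>a * m\<close> is Hermitian, it can be replaced by
    \<open>m\<^sup>\<star> * a\<^sup>\<star>\<close>.\<close>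
  have "a * m * m\<^sup>\<star> = (m * a * m)\<^sup>\<star>"
    unfolding r[symmetric] by (simp only: star_mult mult.assoc)
  then have am: "a * m * m\<^sup>\<star> = m\<^sup>\<star>" by (simp add: m)
  have "a * a\<^sup>\<star> * (m\<^sup>\<star> * m)\<^sup>2 = (a * m * m\<^sup>\<star>) * m"
    by (simp add: power2_eq_square ax mult.assoc[symmetric]) (simp add: ax[symmetric] mult.assoc)
  then have "a * a\<^sup>\<star> * (m\<^sup>\<star> * m)\<^sup>2 = m\<^sup>\<star> * m" by (simp add: am)
  moreover have "m\<^sup>\<star> * m * a * a\<^sup>\<star> * a = a"
  proof -
    \<comment> \<open>Both \<open>m\<^sup>\<star> * m\<close> and \<open>a * a\<^sup>\<star>\<close>
      are Hermitian, so swapping them is starring; the Hermitian value \<open>a * m\<close>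
      survives.\<close>
    have "m\<^sup>\<star> * m * a * a\<^sup>\<star> = (a * a\<^sup>\<star> * (m\<^sup>\<star> * m))\<^sup>\<star>"
      by (simp add: star_mult star_star mult.assoc)
    also have "\<dots> = a * m" by (simp add: ax star_mult r)
    finally show ?thesis by (simp add: m)
  qed
  moreover have "(a * a\<^sup>\<star> * (m\<^sup>\<star> * m))\<^sup>\<star> = a * a\<^sup>\<star> * (m\<^sup>\<star> * m)"
    by (simp only: ax) (simp add: star_mult r)
  ultimately show ?thesis by (simp add: is_w_core_inverse_def)
qed

lemma star_eq_iff: "x\<^sup>\<star> = y\<^sup>\<star> \<longleftrightarrow> x = (y::'a::star_monoid)"
  by (metis star_star)

text \<open>The involution reverses products and so exchanges the two one-sided notions. For
  \<open>v = a\<^sup>\<star>\<close> the right side has the form needed to apply the core results to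
  \<open>a\<^sup>\<star>\<close> in place of \<open>a\<close>.\<close>

lemma is_dual_v_core_inverse_iff_star:
  fixes a v y :: "'a::star_monoid"
  shows "is_dual_v_core_inverse v a y \<longleftrightarrow> is_w_core_inverse (v\<^sup>\<star>) (a\<^sup>\<star>) (y\<^sup>\<star>)"
proof -
  have "a * v * a * y = a \<longleftrightarrow> y\<^sup>\<star> * a\<^sup>\<star> * v\<^sup>\<star> * a\<^sup>\<star> = a\<^sup>\<star>"
    \<comment> \<open>Only the left equation is starred; the outer equivalence is between truth
      values and cannot match.\<close>
    by (subst star_eq_iff[symmetric]) (simp add: star_mult mult.assoc)
  moreover have "y\<^sup>2 * v * a = y \<longleftrightarrow> a\<^sup>\<star> * v\<^sup>\<star> * (y\<^sup>\<star>)\<^sup>2 = y\<^sup>\<star>"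
    by (subst star_eq_iff[symmetric]) (simp add: star_mult mult.assoc power2_eq_square)
  moreover have "(y * v * a)\<^sup>\<star> = y * v * a \<longleftrightarrow> (a\<^sup>\<star> * v\<^sup>\<star> * y\<^sup>\<star>)\<^sup>\<star> = a\<^sup>\<star> * v\<^sup>\<star> * y\<^sup>\<star>"
    by (auto simp: star_mult star_star mult.assoc)
  ultimately show ?thesis
    by (auto simp: is_dual_v_core_inverse_def is_w_core_inverse_def)
qed

text \<open>Starring preserves the first two Penrose equations, while the two Hermitian conditions
  trade places.\<close>

lemma is_mp_inverse_star:
  fixes a m :: "'a::star_monoid"
  assumes "is_mp_inverse a m"
  shows "is_mp_inverse (a\<^sup>\<star>) (m\<^sup>\<star>)"
proof -
  have m: "a * m * a = a" "m * a * m = m" "(a * m)\<^sup>\<star> = a * m" "(m * a)\<^sup>\<star> = m * a"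
    using assms by (simp_all add: is_mp_inverse_def)
  have "a\<^sup>\<star> * m\<^sup>\<star> * a\<^sup>\<star> = (a * m * a)\<^sup>\<star>" "m\<^sup>\<star> * a\<^sup>\<star> * m\<^sup>\<star> = (m * a * m)\<^sup>\<star>"
    by (simp_all only: star_mult mult.assoc)
  moreover have "a\<^sup>\<star> * m\<^sup>\<star> = m * a" "m\<^sup>\<star> * a\<^sup>\<star> = a * m"
    using m(3,4) by (simp_all add: star_mult)
  ultimately show ?thesis
    unfolding is_mp_inverse_def by (metis m)
qed

text \<open>The core result for \<open>a\<^sup>\<star>\<close> and \<open>y\<^sup>\<star>\<close>
  gives \<open>a * y\<close> as Moore-Penrose inverse of \<open>a\<^sup>\<star>\<close>; one more
  star returns to \<open>a\<close>.\<close>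

lemma is_mp_inverse_of_dual_v_core:
  fixes a y :: "'a::star_monoid"
  assumes "is_dual_v_core_inverse (a\<^sup>\<star>) a y"
  shows "is_mp_inverse a ((a * y)\<^sup>\<star>)"
proof -
  have "is_mp_inverse (a\<^sup>\<star>) ((y\<^sup>\<star> * a\<^sup>\<star>)\<^sup>\<star>)"
    using assms by (intro is_mp_inverse_of_w_core) (simp add: is_dual_v_core_inverse_iff_star)
  from is_mp_inverse_star[OF this] show ?thesis by (simp add: star_star star_mult)
qed

text \<open>For \<open>a\<^sup>\<star>\<close> and \<open>m\<^sup>\<star>\<close> the core witness
  is \<open>m * m\<^sup>\<star>\<close>, which is Hermitian and so unchanged on starring
  back.\<close>

lemma is_dual_v_core_inverse_of_mp:
  fixes a m :: "'a::star_monoid"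
  assumes "is_mp_inverse a m"
  shows "is_dual_v_core_inverse (a\<^sup>\<star>) a (m * m\<^sup>\<star>)"
  using is_w_core_inverse_of_mp[OF is_mp_inverse_star[OF assms]]
  by (simp add: is_dual_v_core_inverse_iff_star star_mult star_star)

lemma mp_inverse_eq: "is_mp_inverse a m \<Longrightarrow> a\<^sup>\<dagger> = m"
  unfolding mp_inverse_def by (blast intro: is_mp_inverse_unique)

lemma w_core_inverse_eq: "is_w_core_inverse w a x \<Longrightarrow> w_core_inverse w a = x"
  unfolding w_core_inverse_def by (blast intro: is_w_core_inverse_unique)

lemma dual_v_core_inverse_eq: "is_dual_v_core_inverse v a y \<Longrightarrow> dual_v_core_inverse v a = y"
  unfolding dual_v_core_inverse_def by (blast intro: is_dual_v_core_inverse_unique)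

theorem proposition2p22:
  fixes a :: "'a::star_monoid"
  shows "(w_core_invertible (a\<^sup>\<star>) a \<longleftrightarrow> mp_invertible a)
    \<and> (mp_invertible a \<longleftrightarrow> dual_v_core_invertible (a\<^sup>\<star>) a)
    \<and> (mp_invertible a \<longrightarrow>
         a\<^sup>\<dagger> = (w_core_inverse (a\<^sup>\<star>) a * a)\<^sup>\<star>
       \<and> a\<^sup>\<dagger> = (a * dual_v_core_inverse (a\<^sup>\<star>) a)\<^sup>\<star>
       \<and> w_core_inverse (a\<^sup>\<star>) a = (a\<^sup>\<dagger>)\<^sup>\<star> * a\<^sup>\<dagger>
       \<and> dual_v_core_inverse (a\<^sup>\<star>) a = a\<^sup>\<dagger> * (a\<^sup>\<dagger>)\<^sup>\<star>)"
proof (intro conjI impI)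
  show "w_core_invertible (a\<^sup>\<star>) a \<longleftrightarrow> mp_invertible a"
    unfolding w_core_invertible_def mp_invertible_def
    by (blast intro: is_mp_inverse_of_w_core is_w_core_inverse_of_mp)
  show "mp_invertible a \<longleftrightarrow> dual_v_core_invertible (a\<^sup>\<star>) a"
    unfolding dual_v_core_invertible_def mp_invertible_def
    by (blast intro: is_mp_inverse_of_dual_v_core is_dual_v_core_inverse_of_mp)
  assume "mp_invertible a"
  then obtain m where m: "is_mp_inverse a m" by (auto simp: mp_invertible_def)
  note w = is_w_core_inverse_of_mp[OF m] and d = is_dual_v_core_inverse_of_mp[OF m]
  show "a\<^sup>\<dagger> = (w_core_inverse (a\<^sup>\<star>) a * a)\<^sup>\<star>"
    \<comment> \<open>The explicit core inverse \<open>m\<^sup>\<star> * m\<close> is fed back into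
      the converse construction; uniqueness of the Moore-Penrose inverse then replaces any
      computation.\<close>
    using mp_inverse_eq[OF is_mp_inverse_of_w_core[OF w]] w_core_inverse_eq[OF w] by simp
  show "a\<^sup>\<dagger> = (a * dual_v_core_inverse (a\<^sup>\<star>) a)\<^sup>\<star>"
    using mp_inverse_eq[OF is_mp_inverse_of_dual_v_core[OF d]] dual_v_core_inverse_eq[OF d] by simp
  show "w_core_inverse (a\<^sup>\<star>) a = (a\<^sup>\<dagger>)\<^sup>\<star> * a\<^sup>\<dagger>"
    by (simp add: mp_inverse_eq[OF m] w_core_inverse_eq[OF w])
  show "dual_v_core_inverse (a\<^sup>\<star>) a = a\<^sup>\<dagger> * (a\<^sup>\<dagger>)\<^sup>\<star>"
    by (simp add: mp_inverse_eq[OF m] dual_v_core_inverse_eq[OF d])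
qed

end
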